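(* Let $0<f<1$ and $R>0$. Suppose a large rollup with arrival rate $R$ and a small rollup with arrival rate $Rf$ both post blobs in an equilibrium with blob price $B$, and let $B^N$ be the blob price in an equilibrium after these two rollups join in posting blobs. Let $B_1$ be the Nash bargaining payment of the large rollup towards the joint blob. Then $$B_1\ge \frac{B^N}{2}.$$
   Context: Fixed parameters: $a,G,P_1>0$ and a target $k>0$ of blobs per time unit; metadata costs are zero ($P_0=0$). At blob price $B$, a rollup with transaction arrival rate $R>0$ has optimal cost per transaction $\sqrt{2Ba/R}$ when posting blobs (posting every $\sqrt{2B/(aR)}$ time units) and $P_1G$ when posting directly on the L1 main market. Each rollup uses the cheaper strategy (either one in case of a tie). An equilibrium for a finite family of rollups with rates $(R_l)_{l\in I}$, $R_l>0$, is a pair $(B,S)$ with blob price $B>0$ and set $\emptyset\ne S\subseteq I$ of blob-posting rollups such that $B=\frac{a}{2k^2}\bigl(\sum_{l\in S}\sqrt{R_l}\bigr)^2$ (the target of $k$ blobs per time unit is met), $\sqrt{2Ba/R_l}\le P_1G$ for $l\in S$, and $\sqrt{2Ba/R_l}\ge P_1G$ for $l\in I\setminus S$. When two rollups join in posting blobs they are replaced by a single rollup whose rate is the sum of their rates; an equilibrium after joining is an equilibrium $(B^N,S^N)$ of the new family in which the joint rollup belongs to $S^N$. There may be any finite number of other rollups. Cost sharing. Posting alone at price $B$, the per-transaction costs are $Tr_L=\sqrt{2Ba/R}$ (large) and $Tr_S=\sqrt{2Ba/(Rf)}$ (small). A joint blob is posted every $t_J=\sqrt{\frac{2B^N}{(1+f)aR}}$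 time units and contains $C_J=\sqrt{2B^NR(1+f)/a}$ transactions, of which $C_{J,L}=\frac{C_J}{1+f}$ are from the large and $C_{J,S}=\frac{fC_J}{1+f}$ from the small rollup. The total delay costs per joint blob are $d_{J,L}=\frac{aRt_J^2}{2}$ and $d_{J,S}=\frac{aRft_J^2}{2}$. If the large rollup pays $B_1$ and the small rollup pays $B^N-B_1$ of the joint blob price, the Nash bargaining payment $B_1$ is the maximizer over $B_1$ of the (rescaled) Nash product $$(B_1+d_{J,L}-C_{J,L}Tr_L)(B^N-B_1+d_{J,S}-C_{J,S}Tr_S),$$ that is, $B_1=\tfrac12\bigl(B^N+d_{J,S}-d_{J,L}-C_{J,S}Tr_S+C_{J,L}Tr_L\bigr)$. *)

theory Defs
  imports Complex_Main
begin

text \<open>Per-transaction cost of a rollup with arrival rate \<open>R\<close> when it posts blobs on its own at blob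
  price \<open>B\<close> with the cost-minimizing posting period (no metadata costs).\<close>

definition blob_cost :: "real \<Rightarrow> real \<Rightarrow> real \<Rightarrow> real" where
  "blob_cost a B R = sqrt (2 * B * a / R)"

definition equilibrium ::
  "real \<Rightarrow> real \<Rightarrow> real \<Rightarrow> real \<Rightarrow> 'i set \<Rightarrow> ('i \<Rightarrow> real) \<Rightarrow> real \<Rightarrow> 'i set \<Rightarrow> bool" where
  "equilibrium a G P1 k I rate B S \<longleftrightarrow>
     B > 0 \<and> S \<noteq> {} \<and> S \<subseteq> I \<and>
     B = a / (2 * k\<^sup>2) * (\<Sum>i\<in>S. sqrt (rate i))\<^sup>2 \<and>
     (\<forall>i\<in>S. blob_cost a B (rate i) \<le> P1 * G) \<and>
     (\<forall>i\<in>I - S. blob_cost a B (rate i) \<ge> P1 * G)"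

text \<open>After \<open>l\<close> and \<open>s\<close> join, \<open>None\<close> is the joint rollup; every other rollup \<open>i\<close> becomes
  \<open>Some i\<close> and keeps its rate.\<close>

definition joined_rollups :: "'i \<Rightarrow> 'i \<Rightarrow> 'i set \<Rightarrow> 'i option set" where
  "joined_rollups l s I = insert None (Some ` (I - {l, s}))"

definition joined_rate :: "'i \<Rightarrow> 'i \<Rightarrow> ('i \<Rightarrow> real) \<Rightarrow> 'i option \<Rightarrow> real" where
  "joined_rate l s rate j = (case j of None \<Rightarrow> rate l + rate s | Some i \<Rightarrow> rate i)"

definition joint_period :: "real \<Rightarrow> real \<Rightarrow> real \<Rightarrow> real \<Rightarrow> real" where
  "joint_period a R f BN = sqrt (2 * BN / ((1 + f) * a * R))"

definition joint_txs :: "real \<Rightarrow> real \<Rightarrow> real \<Rightarrow> real \<Rightarrow> real" where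
  "joint_txs a R f BN = sqrt (2 * BN * R * (1 + f) / a)"

text \<open>Total delay cost, over one posting period of length \<open>t\<close>, of a rollup with rate \<open>r\<close>.\<close>

definition delay_cost :: "real \<Rightarrow> real \<Rightarrow> real \<Rightarrow> real" where
  "delay_cost a r t = a * r * t\<^sup>2 / 2"

text \<open>The arguments \<open>B\<close> and \<open>BN\<close> are the blob prices before and after joining; \<open>x\<close> is the part of
  the joint blob price \<open>BN\<close> paid by the large rollup (rate \<open>R\<close>), the small one (rate \<open>R * f\<close>)
  paying \<open>BN - x\<close>. The disagreement point is posting alone at the old price \<open>B\<close>.\<close>

definition nash_product :: "real \<Rightarrow> real \<Rightarrow> real \<Rightarrow> real \<Rightarrow> real \<Rightarrow> real \<Rightarrow> real" where
  "nash_product a R f B BN x =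
     (let t = joint_period a R f BN; C = joint_txs a R f BN in
       (x + delay_cost a R t - C / (1 + f) * blob_cost a B R) *
       (BN - x + delay_cost a (R * f) t - f * C / (1 + f) * blob_cost a B (R * f)))"

definition nash_payment :: "real \<Rightarrow> real \<Rightarrow> real \<Rightarrow> real \<Rightarrow> real \<Rightarrow> real \<Rightarrow> bool" where
  "nash_payment a R f B BN B1 \<longleftrightarrow> is_arg_max (nash_product a R f B BN) (\<lambda>_. True) B1"

lemma nash_payment_iff:
  "nash_payment a R f B BN B1 \<longleftrightarrow>
     (let t = joint_period a R f BN; C = joint_txs a R f BN in
       B1 = (BN + delay_cost a (R * f) t - delay_cost a R t
              - f * C / (1 + f) * blob_cost a B (R * f) + C / (1 + f) * blob_cost a B R) / 2)"
proof -
  have max: "is_arg_max (\<lambda>x. (x + d - u) * (b - x + e - v)) (\<lambda>_. True) y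
      \<longleftrightarrow> y = (b + e - d - v + u) / 2" for b d e u v y :: real
  proof -
    define m where "m = (b + e - d - v + u) / 2"
    have sq: "(x + d - u) * (b - x + e - v) = ((b + d + e - u - v) / 2)\<^sup>2 - (x - m)\<^sup>2" for x
      unfolding m_def by (simp add: field_simps power2_eq_square)
    have "(\<forall>x. (y - m)\<^sup>2 \<le> (x - m)\<^sup>2) \<longleftrightarrow> y = m"
    proof
      assume "\<forall>x. (y - m)\<^sup>2 \<le> (x - m)\<^sup>2"
      then have "(y - m)\<^sup>2 \<le> (m - m)\<^sup>2" by blast
      then show "y = m" by simp
    qed simp
    then show ?thesis
      unfolding is_arg_max_def sq m_def[symmetric] by (simp add: not_less)
  qed
  show ?thesis
    unfolding nash_payment_def nash_product_def Let_def max ..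
qed

end

theory Submission
  imports Defs
begin

text \<open>
  Joining cannot raise the blob price. If \<open>BN > B\<close>, every rollup posting blobs at price \<open>BN\<close> would
  strictly prefer blobs at price \<open>B\<close>, so no further rollup enters; as
  \<open>sqrt (R + R * f) \<le> sqrt R + sqrt (R * f)\<close>, the sum determining the price does not grow, a
  contradiction. Substituting the period and the number of transactions,
  \<open>2 * B1 - BN = 2 * (1 - sqrt f) * sqrt (BN * B / (1 + f)) - BN * (1 - f) / (1 + f)\<close>. After division
  by \<open>1 - sqrt f\<close>, nonnegativity amounts to \<open>(1 + sqrt f)\<^sup>2 * BN \<le> 4 * (1 + f) * B\<close>, and
  \<open>(1 + sqrt f)\<^sup>2 \<le> 2 * (1 + f)\<close>.
\<close>

lemma blob_cost_strict_mono:
  assumes "a > 0" "R > 0" "B < B'"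
  shows "blob_cost a B R < blob_cost a B' R"
  using assms unfolding blob_cost_def by (simp add: divide_strict_right_mono)

text \<open>No uniqueness of equilibria is used: any equilibrium after joining in which the joint
  rollup posts blobs is compared with the given one before joining.\<close>

lemma blob_price_joined_le:
  fixes a G P1 k B BN :: real
  assumes a: "a > 0" and fin: "finite I" and pos: "\<And>i. i \<in> I \<Longrightarrow> rate i > 0"
    and eq: "equilibrium a G P1 k I rate B S" and l: "l \<in> S" and s: "s \<in> S" and ls: "l \<noteq> s"
    and eqN: "equilibrium a G P1 k (joined_rollups l s I) (joined_rate l s rate) BN SN"
    and None: "None \<in> SN"
  shows "BN \<le> B"
proof (rule ccontr)
  assume "\<not> BN \<le> B"
  then have less: "B < BN" by simp
  have SI: "S \<subseteq> I" and B: "B = a / (2 * k\<^sup>2) * (\<Sum>i\<in>S. sqrt (rate i))\<^sup>2"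
    and out: "\<And>i. i \<in> I - S \<Longrightarrow> P1 * G \<le> blob_cost a B (rate i)"
    using eq unfolding equilibrium_def by auto
  have SNI: "SN \<subseteq> joined_rollups l s I"
    and BN: "BN = a / (2 * k\<^sup>2) * (\<Sum>j\<in>SN. sqrt (joined_rate l s rate j))\<^sup>2"
    and inN: "\<And>j. j \<in> SN \<Longrightarrow> blob_cost a BN (joined_rate l s rate j) \<le> P1 * G"
    using eqN unfolding equilibrium_def by auto
  have finS: "finite S" using SI fin by (rule finite_subset)
  have posS: "rate i > 0" if "i \<in> S" for i using that SI pos by blast
  define T where "T = {i. Some i \<in> SN}"
  have T: "T \<subseteq> S - {l, s}"
  proof
    fix i assume "i \<in> T"
    then have iN: "Some i \<in> SN" by (simp add: T_def)
    then have i: "i \<in> I" "i \<notin> {l, s}"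
      using SNI unfolding joined_rollups_def by auto
    have "i \<in> S"
    proof (rule ccontr)
      assume "i \<notin> S"
      \<comment> \<open>Ties are allowed in both equilibria, so the contradiction comes from strict
        monotonicity in the price.\<close>
      then have "P1 * G \<le> blob_cost a B (rate i)" using out i by blast
      also have "\<dots> < blob_cost a BN (rate i)"
        using a pos[OF i(1)] less by (rule blob_cost_strict_mono)
      also have "\<dots> \<le> P1 * G" using inN[OF iN] by (simp add: joined_rate_def)
      finally show False by simp
    qed
    then show "i \<in> S - {l, s}" using i by blast
  qed
  have finT: "finite T" using T finS by (meson finite_Diff finite_subset)
  have SN: "SN = insert None (Some ` T)"
  proof (rule set_eqI)
    fix j show "j \<in> SN \<longleftrightarrow> j \<in> insert None (Some ` T)"
      using None by (cases j) (auto simp: T_def)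
  qed
  have "(\<Sum>j\<in>SN. sqrt (joined_rate l s rate j)) = sqrt (rate l + rate s) + (\<Sum>i\<in>T. sqrt (rate i))"
    unfolding SN using finT by (simp add: sum.reindex joined_rate_def)
  also have "\<dots> \<le> sqrt (rate l) + sqrt (rate s) + (\<Sum>i\<in>S - {l, s}. sqrt (rate i))"
  proof (rule add_mono)
    show "sqrt (rate l + rate s) \<le> sqrt (rate l) + sqrt (rate s)"
      using posS[OF l] posS[OF s] by (intro sqrt_add_le_add_sqrt) auto
    show "(\<Sum>i\<in>T. sqrt (rate i)) \<le> (\<Sum>i\<in>S - {l, s}. sqrt (rate i))"
      using T finS posS by (intro sum_mono2) (auto simp: less_imp_le)
  qed
  also have "\<dots> = (\<Sum>i\<in>S. sqrt (rate i))"
    using sum.subset_diff[of "{l, s}" S "\<lambda>i. sqrt (rate i)"] l s ls finS by simp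
  finally have le: "(\<Sum>j\<in>SN. sqrt (joined_rate l s rate j)) \<le> (\<Sum>i\<in>S. sqrt (rate i))" .
  \<comment> \<open>The price is quadratic in this sum, so squaring \<open>le\<close> needs its
    smaller side nonnegative.\<close>
  have "0 \<le> (\<Sum>j\<in>SN. sqrt (joined_rate l s rate j))"
    unfolding SN using finT posS[OF l] posS[OF s] posS T
    by (intro sum_nonneg) (auto simp: joined_rate_def less_imp_le subset_iff)
  then have "BN \<le> B"
    unfolding B BN using le a by (intro mult_left_mono power_mono) auto
  then show False using less by simp
qed

text \<open>Of the two equilibria, only \<open>0 < BN\<close> and \<open>BN \<le> B\<close> enter;
  the rest is algebra in \<open>g = sqrt f\<close>.\<close>

lemma nash_payment_ge_half:
  fixes a R f B BN B1 :: real
  assumes a: "a > 0" and R: "R > 0" and f: "0 < f" "f < 1" and BN: "0 < BN" "BN \<le> B"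
    and pay: "nash_payment a R f B BN B1"
  shows "BN / 2 \<le> B1"
proof -
  define g where "g = sqrt f"
  have g: "0 < g" "g < 1" "g\<^sup>2 = f" using f by (auto simp: g_def)
  define q where "q = sqrt (BN * B / (1 + f))"
  define t where "t = joint_period a R f BN"
  define C where "C = joint_txs a R f BN"
  have t2: "t\<^sup>2 = 2 * BN / ((1 + f) * a * R)"
    unfolding t_def joint_period_def using a R f BN by simp
  \<comment> \<open>At the optimal period the total delay cost equals the blob price, split in the
    ratio \<open>1 : f\<close>.\<close>
  have dL: "delay_cost a R t = BN / (1 + f)" and dS: "delay_cost a (R * f) t = f * BN / (1 + f)"
    unfolding delay_cost_def t2 using a R f by (auto simp: divide_simps)
  have "C * blob_cost a B R = sqrt ((2 * BN * R * (1 + f) / a) * (2 * B * a / R))"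
    unfolding C_def joint_txs_def blob_cost_def real_sqrt_mult ..
  also have "(2 * BN * R * (1 + f) / a) * (2 * B * a / R) = (2 * (1 + f))\<^sup>2 * (BN * B / (1 + f))"
    using a R f by (simp add: divide_simps) (simp add: power2_eq_square algebra_simps)
  also have "sqrt \<dots> = 2 * (1 + f) * q"
    unfolding q_def real_sqrt_mult using f by simp
  finally have "C * blob_cost a B R = 2 * (1 + f) * q" .
  then have cL: "C / (1 + f) * blob_cost a B R = 2 * q"
    using f by (simp add: field_simps)
  \<comment> \<open>The small rollup has \<open>f\<close> times as many transactions, each dearer by
    the factor \<open>1 / g\<close>: its total is \<open>f / g = g\<close> times that of the large
    one.\<close>
  have "blob_cost a B (R * f) = sqrt (2 * B * a / R / f)"
    unfolding blob_cost_def by (simp add: divide_divide_eq_left)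
  also have "\<dots> = blob_cost a B R / g"
    unfolding blob_cost_def g_def by (rule real_sqrt_divide)
  finally have "f * C / (1 + f) * blob_cost a B (R * f)
      = f / g * (C / (1 + f) * blob_cost a B R)" by (simp add: mult_ac)
  also have "f / g = g" using g by (simp add: field_simps power2_eq_square flip: g(3))
  finally have cS: "f * C / (1 + f) * blob_cost a B (R * f) = g * (2 * q)" unfolding cL .
  have B1: "2 * B1 = BN + f * BN / (1 + f) - BN / (1 + f) - g * (2 * q) + 2 * q"
    using pay[unfolded nash_payment_iff Let_def, folded t_def C_def, unfolded dL dS cL cS] by simp
  \<comment> \<open>The difference of the two sides is \<open>(1 - g)\<^sup>2\<close>.\<close>
  have "(1 + g)\<^sup>2 \<le> 2 * (1 + f)"
    using zero_le_power2[of "1 - g"] g(3) by (simp add: power2_eq_square algebra_simps)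
  then have "(1 + g)\<^sup>2 * BN \<le> 4 * (1 + f) * B"
    using BN f mult_mono[of "(1 + g)\<^sup>2" "4 * (1 + f)" BN B] by simp
  \<comment> \<open>The factor makes the left side a perfect square and the right side the radicand
    of \<open>q\<close>.\<close>
  then have "((1 + g)\<^sup>2 * BN) * (BN / (4 * (1 + f)\<^sup>2)) \<le> (4 * (1 + f) * B) * (BN / (4 * (1 + f)\<^sup>2))"
    using BN by (intro mult_right_mono) auto
  also have "\<dots> = BN * B / (1 + f)"
    using f by (simp add: divide_simps) (simp add: power2_eq_square algebra_simps)
  also have "((1 + g)\<^sup>2 * BN) * (BN / (4 * (1 + f)\<^sup>2)) = ((1 + g) * BN / (2 * (1 + f)))\<^sup>2"
    unfolding power_divide power_mult_distrib by (simp add: power2_eq_square)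
  finally have "(1 + g) * BN / (2 * (1 + f)) \<le> q"
    unfolding q_def by (rule real_le_rsqrt)
  \<comment> \<open>Since \<open>(1 - g) * (1 + g) = 1 - f\<close>, the left side becomes the
    difference of the delay costs in \<open>B1\<close>.\<close>
  then have "2 * (1 - g) * ((1 + g) * BN / (2 * (1 + f))) \<le> 2 * (1 - g) * q"
    using g by (intro mult_left_mono) auto
  also have "2 * (1 - g) * ((1 + g) * BN / (2 * (1 + f))) = (1 - g\<^sup>2) * BN / (1 + f)"
    using f by (simp add: divide_simps) (simp add: power2_eq_square algebra_simps)
  also have "\<dots> = BN / (1 + f) - f * BN / (1 + f)"
    unfolding g(3) by (simp add: left_diff_distrib diff_divide_distrib)
  finally show ?thesis using B1 by (simp add: algebra_simps)
qed

theorem proposition7: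
  fixes a G P1 k R f B BN B1 :: real
    and I S :: "'i set" and SN :: "'i option set"
    and rate :: "'i \<Rightarrow> real" and l s :: 'i
  assumes "a > 0" "G > 0" "P1 > 0" "k > 0"
    and "0 < f" "f < 1" "R > 0"
    and "finite I" "\<And>i. i \<in> I \<Longrightarrow> rate i > 0"
    and "l \<in> I" "s \<in> I" "l \<noteq> s" "rate l = R" "rate s = R * f"
    and "equilibrium a G P1 k I rate B S" "l \<in> S" "s \<in> S"
    and "equilibrium a G P1 k (joined_rollups l s I) (joined_rate l s rate) BN SN" "None \<in> SN"
    and "nash_payment a R f B BN B1"
  shows "B1 \<ge> BN / 2"
proof -
  have "BN \<le> B"
    by (rule blob_price_joined_le[OF assms(1,8,9,15-17,12,18,19)])
  moreover have "BN > 0" using assms(18) unfolding equilibrium_def by simp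
  ultimately show ?thesis using assms by (intro nash_payment_ge_half[of a R f BN B B1]) auto
qed

end
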